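(* Let $\widetilde F:\mathbb R^m\to\mathbb R$ be differentiable and let $(z_k)_{k\in\mathbb N_0}$ be generated by $z_{k+1}=z_k+t_ks_k$, with $z_0\in\mathbb R^m$ and $t_k>0$. For each $k$ let $g_k=\overline\nabla\widetilde F(z_k)\in\mathbb R^m$ be the inexact gradient at $z_k$. Suppose there are constants $c_1',c_2'>0$ with $c_1'/c_2'\le1$ such that $$c_1'\|g_k\|_2^2\le-g_k^{\mathsf T}s_k,\qquad \|s_k\|_2\le c_2'\|g_k\|_2,\qquad k\in\mathbb N_0,$$ and suppose that for some $\zeta\in[0,c_1'/c_2')$, $$\|g_k-\nabla\widetilde F(z_k)\|_2\le\zeta\|g_k\|_2,\qquad k\in\mathbb N_0.$$ Then $(s_k)_{k\in\mathbb N_0}$ satisfies $$c_1\|\nabla\widetilde F(z_k)\|_2^2\le-\nabla\widetilde F(z_k)^{\mathsf T}s_k,\qquad \|s_k\|_2\le c_2\|\nabla\widetilde F(z_k)\|_2,\qquad k\in\mathbb N_0,$$ where $$c_1=\frac{c_1'-\zeta c_2'}{(1+\zeta)^2},\qquad c_2=\frac{c_2'}{1-\zeta}.$$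
   Context: $\|\cdot\|_2$ is the Euclidean norm on $\mathbb R^m$ and $\mathbb N_0=\{0,1,2,\dots\}$. The inexact gradient $\overline\nabla\widetilde F(z_k)$ is an arbitrary vector in $\mathbb R^m$ approximating the exact gradient $\nabla\widetilde F(z_k)$, subject only to the stated hypotheses. *)

theory Defs
  imports "HOL-Analysis.Analysis"
begin

text \<open>The library has the relation \<open>GDERIV f x :> D\<close> (\<open>D\<close> is the gradient of
  \<open>f\<close> at \<open>x\<close>), but no gradient function. The value below is unspecified where \<open>f\<close>
  is not differentiable.\<close>

definition gradient :: "('a::euclidean_space \<Rightarrow> real) \<Rightarrow> 'a \<Rightarrow> 'a" where
  "gradient f x = (THE D. GDERIV f x :> D)"

lemma gradient_eqI:
  assumes "GDERIV f x :> D"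
  shows "gradient f x = D"
  unfolding gradient_def
proof (rule the_equality)
  fix E assume "GDERIV f x :> E"
  with assms have "(\<lambda>h. inner h E) = (\<lambda>h. inner h D)"
    unfolding gderiv_def by (blast intro: has_derivative_unique)
  then show "E = D"
    by (metis vector_eq_ldot)
qed (rule assms)

lemma GDERIV_gradient:
  assumes "f differentiable (at x)"
  shows "GDERIV f x :> gradient f x"
proof -
  obtain f' where f': "(f has_derivative f') (at x)"
    using assms by (auto simp: differentiable_def)
  then have lin: "linear f'"
    by (rule has_derivative_linear)
  define D where "D = (\<Sum>b\<in>Basis. f' b *\<^sub>R b)"
  have "f' h = inner h D" for h
  proof -
    have "f' h = f' (\<Sum>b\<in>Basis. inner h b *\<^sub>R b)"
      by (simp add: euclidean_representation)
    also have "\<dots> = (\<Sum>b\<in>Basis. inner h b * f' b)"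
      by (simp add: linear_sum[OF lin] linear_cmul[OF lin])
    also have "\<dots> = inner h D"
      by (simp add: D_def inner_sum_right mult.commute)
    finally show ?thesis .
  qed
  then have "f' = (\<lambda>h. inner h D)"
    by (rule ext)
  with f' have "GDERIV f x :> D"
    by (simp add: gderiv_def)
  then show ?thesis
    by (simp add: gradient_eqI)
qed

end

theory Submission
  imports Defs
begin

text \<open>The argument is pointwise in \<open>k\<close>. By the triangle inequality, the relative
  error bound makes the two norms comparable: the exact gradient has norm between
  \<open>(1 - \<zeta>) * norm (g k)\<close> and \<open>(1 + \<zeta>) * norm (g k)\<close>. By
  Cauchy-Schwarz, exchanging \<open>g k\<close> for the exact gradient in the product with
  \<open>s k\<close> costs at most \<open>\<zeta> * c2' * (norm (g k))\<^sup>2\<close>, less than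
  the descent term supplies when \<open>g k\<close> is nonzero. Comparability then turns bounds in
  \<open>norm (g k)\<close> into the claimed ones.\<close>

theorem theorem4p6:
  fixes F :: "real ^ 'm \<Rightarrow> real"
    and z s g :: "nat \<Rightarrow> real ^ 'm"
    and t :: "nat \<Rightarrow> real"
    and c1' c2' \<zeta> :: real
  assumes differentiable: "\<And>x. F differentiable (at x)"
    and step: "\<And>k. z (Suc k) = z k + t k *\<^sub>R s k"
    and t_pos: "\<And>k. t k > 0"
    and c1'_pos: "c1' > 0"
    and c2'_pos: "c2' > 0"
    and c1'_c2': "c1' / c2' \<le> 1"
    and descent: "\<And>k. c1' * (norm (g k))\<^sup>2 \<le> - (g k \<bullet> s k)"
    and step_bound: "\<And>k. norm (s k) \<le> c2' * norm (g k)"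
    and \<zeta>: "\<zeta> \<in> {0..<c1' / c2'}"
    and inexact: "\<And>k. norm (g k - gradient F (z k)) \<le> \<zeta> * norm (g k)"
  shows "\<forall>k. ((c1' - \<zeta> * c2') / (1 + \<zeta>)\<^sup>2) * (norm (gradient F (z k)))\<^sup>2
                \<le> - (gradient F (z k) \<bullet> s k)
           \<and> norm (s k) \<le> (c2' / (1 - \<zeta>)) * norm (gradient F (z k))"
proof (intro allI conjI)
  fix k
  let ?d = "gradient F (z k)"
  have \<zeta>0: "0 \<le> \<zeta>" and \<zeta>1: "\<zeta> < 1"
    using \<zeta> c1'_c2' by auto
  \<comment> \<open>This is where \<zeta> below \<open>c1' / c2'\<close> enters: the descent
    constant left after the perturbation keeps its sign, so inequalities may be multiplied by
    it.\<close>
  have c: "0 \<le> c1' - \<zeta> * c2'"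
    using \<zeta> c2'_pos by (simp add: less_divide_eq)
  have upper: "norm ?d \<le> (1 + \<zeta>) * norm (g k)"
    using norm_triangle_sub[of ?d "g k"] inexact[of k]
    by (simp add: norm_minus_commute algebra_simps)
  have lower: "(1 - \<zeta>) * norm (g k) \<le> norm ?d"
    using norm_triangle_sub[of "g k" ?d] inexact[of k] by (simp add: algebra_simps)

  \<comment> \<open>Write \<open>- (g k \<bullet> s k)\<close> as this error term plus
    \<open>- (?d \<bullet> s k)\<close>; bounding the error from above leaves a lower bound for the
    latter.\<close>
  have "- ((g k - ?d) \<bullet> s k) \<le> norm (g k - ?d) * norm (s k)"
    using Cauchy_Schwarz_ineq2[of "g k - ?d" "s k"] by linarith
  also have "\<dots> \<le> (\<zeta> * norm (g k)) * (c2' * norm (g k))"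
    using \<zeta>0 by (intro mult_mono inexact step_bound) auto
  finally have "(c1' - \<zeta> * c2') * (norm (g k))\<^sup>2 \<le> - (?d \<bullet> s k)"
    using descent[of k] by (simp add: inner_diff_left power2_eq_square algebra_simps)
  moreover have "(norm ?d)\<^sup>2 \<le> (1 + \<zeta>)\<^sup>2 * (norm (g k))\<^sup>2"
    using power_mono[OF upper, of 2] by (simp add: power_mult_distrib)
  then have "(norm ?d)\<^sup>2 / (1 + \<zeta>)\<^sup>2 \<le> (norm (g k))\<^sup>2"
    using \<zeta>0 by (simp add: divide_le_eq mult.commute)
  then have "(c1' - \<zeta> * c2') * ((norm ?d)\<^sup>2 / (1 + \<zeta>)\<^sup>2) \<le> (c1' - \<zeta> * c2') * (norm (g k))\<^sup>2"
    using c by (rule mult_left_mono)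
  ultimately show "((c1' - \<zeta> * c2') / (1 + \<zeta>)\<^sup>2) * (norm ?d)\<^sup>2 \<le> - (?d \<bullet> s k)"
    by simp

  \<comment> \<open>The step bound needs the opposite comparison, \<open>norm (g k)\<close> from
    above; dividing is safe since \<zeta> < 1.\<close>
  have "norm (g k) \<le> norm ?d / (1 - \<zeta>)"
    using lower \<zeta>1 by (simp add: le_divide_eq mult.commute)
  then have "c2' * norm (g k) \<le> c2' * (norm ?d / (1 - \<zeta>))"
    using c2'_pos by (intro mult_left_mono) auto
  then show "norm (s k) \<le> (c2' / (1 - \<zeta>)) * norm ?d"
    using step_bound[of k] by simp
qed

end
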